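(* $F(S(a,b))=\Theta(a^{3/2}+ab)$; that is, there exist real constants $c_1,c_2>0$ such that for all integers $a\geq 2$, $b\geq 1$ with $\gcd(a,b)=1$, $$c_1\,(a^{3/2}+ab)\leq F(S(a,b))\leq c_2\,(a^{3/2}+ab).$$
   Context: $\mathbb{N}_0=\{0,1,2,\ldots\}$ and $\binom{n}{2}=\frac{n(n-1)}{2}$. For $a,b\in\mathbb{N}_0$, $S(a,b)$ is the submonoid of $(\mathbb{N}_0,+)$ generated by $\left\{na+\binom{n}{2}b : n\in\mathbb{N}_0\right\}$; it is a numerical semigroup (a submonoid of $\mathbb{N}_0$ with finite complement) exactly when $\gcd(a,b)=1$. For a numerical semigroup $S$, the Frobenius number $F(S)$ is the greatest integer not in $S$. *)

theory Defs
  imports Complex_Main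
begin

definition add_submonoid :: "nat set \<Rightarrow> bool" where
  "add_submonoid M \<longleftrightarrow> 0 \<in> M \<and> (\<forall>x\<in>M. \<forall>y\<in>M. x + y \<in> M)"

definition S :: "nat \<Rightarrow> nat \<Rightarrow> nat set" where
  "S a b = add_submonoid hull {n * a + (n choose 2) * b | n. True}"

(* The maximum is taken over all integers, so that the Frobenius number of the
   full semigroup is -1.  The value is only meaningful when the complement of M
   in the natural numbers is finite. *)
definition Frobenius :: "nat set \<Rightarrow> int" where
  "Frobenius M = (GREATEST z. z \<notin> int ` M)"

end

theory Submission
  imports Defs "HOL-Number_Theory.Cong"
begin

text \<open>
  Every element of \<open>S a b\<close> has the form \<open>a s + b t\<close> with \<open>t \<le> s choose 2\<close>. Conversely,
  \<open>a s + b t\<close> is an element as soon as \<open>s\<close> exceeds a constant multiple of the square root of \<open>t\<close>,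
  because removing the largest \<open>n choose 2\<close> from \<open>t\<close> leaves a remainder less than \<open>n\<close>.
  Each residue class modulo \<open>a\<close> contains some \<open>b t\<close> with \<open>1 \<le> t \<le> a\<close>, which gives the upper
  bound. For the lower bound, \<open>b (a - 1) + a s\<close> is missed by the semigroup whenever
  \<open>s choose 2 < a - 1\<close>.
\<close>

lemma two_times_choose_two: "2 * (n choose 2) + n = n * n"
  by (induction n) (simp_all add: numeral_2_eq_2)

lemma Suc_choose_two: "Suc n choose 2 = (n choose 2) + n"
  by (simp add: numeral_2_eq_2)

lemma choose_two_add: "(m + n) choose 2 = (m choose 2) + (n choose 2) + m * n"
  by (induction n) (simp_all add: Suc_choose_two)

text \<open>The bracket around \<open>t\<close> has length \<open>n\<close>, so
  \<open>t - (n choose 2)\<close> is less than \<open>n\<close>. Requiring \<open>n \<ge> 1\<close>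
  excludes the empty bracket at 0.\<close>

lemma ex_choose_two_bracket:
  "\<exists>n\<ge>1. (n choose 2) \<le> t \<and> t < (Suc n choose 2)"
proof (induction t)
  case 0
  show ?case by (rule exI[of _ 1]) (simp add: Suc_choose_two)
next
  case (Suc t)
  then obtain n where n: "n \<ge> 1" "(n choose 2) \<le> t" "t < (Suc n choose 2)" by blast
  show ?case
  proof (cases "Suc t < (Suc n choose 2)")
    case True
    with n show ?thesis by (intro exI[of _ n]) auto
  next
    case False
    with n show ?thesis by (intro exI[of _ "Suc n"]) (auto simp: Suc_choose_two)
  qed
qed

lemma add_submonoid_S: "add_submonoid (S a b)"
  unfolding S_def by (rule hull_in) (auto simp: add_submonoid_def)

lemma generator_in_S: "n * a + (n choose 2) * b \<in> S a b"
  unfolding S_def by (rule hull_inc) blast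

lemma add_submonoid_mult:
  assumes "add_submonoid M" "x \<in> M"
  shows "k * x \<in> M"
  by (induction k) (use assms in \<open>auto simp: add_submonoid_def\<close>)

text \<open>The sums of this form contain all generators and are closed under addition, since
  \<open>choose_two_add\<close> makes \<open>n choose 2\<close> superadditive.\<close>

lemma in_S_E:
  assumes "x \<in> S a b"
  obtains s t where "x = a * s + b * t" "t \<le> (s choose 2)"
proof -
  let ?M = "{a * s + b * t | s t. t \<le> (s choose 2)}"
  have "add_submonoid ?M"
    unfolding add_submonoid_def
  proof (intro conjI ballI)
    show "0 \<in> ?M" by auto
    fix x y assume "x \<in> ?M" "y \<in> ?M"
    then obtain s t s' t' where st: "x = a * s + b * t" "t \<le> (s choose 2)"
      "y = a * s' + b * t'" "t' \<le> (s' choose 2)" by blast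
    have "x + y = a * (s + s') + b * (t + t')" using st by (simp add: algebra_simps)
    moreover have "t + t' \<le> ((s + s') choose 2)" using st by (simp add: choose_two_add)
    ultimately show "x + y \<in> ?M" by blast
  qed
  moreover have "{n * a + (n choose 2) * b | n. True} \<subseteq> ?M"
  proof
    fix x assume "x \<in> {n * a + (n choose 2) * b | n. True}"
    then obtain n where "x = a * n + b * (n choose 2)" by (auto simp: mult.commute)
    then show "x \<in> ?M" by blast
  qed
  ultimately have "S a b \<subseteq> ?M"
    unfolding S_def by (intro hull_minimal)
  with assms that show thesis by blast
qed

text \<open>The sum uses the generator of index \<open>n\<close> once, \<open>2 * a + b\<close>
  (index 2) \<open>r\<close> times, and \<open>a\<close> (index 1) for the surplus
  \<open>s - (n + 2 * r)\<close>.\<close>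

lemma in_S_I:
  assumes "n + 2 * r \<le> s"
  shows "a * s + b * ((n choose 2) + r) \<in> S a b"
proof -
  have closed: "x + y \<in> S a b" if "x \<in> S a b" "y \<in> S a b" for x y
    using add_submonoid_S that unfolding add_submonoid_def by blast
  have "r * (2 * a + b) \<in> S a b" "(s - (n + 2 * r)) * a \<in> S a b"
    using generator_in_S[of 2 a b] generator_in_S[of 1 a b]
    by (auto simp: binomial_eq_0 intro!: add_submonoid_mult add_submonoid_S)
  then have "n * a + (n choose 2) * b + r * (2 * a + b) + (s - (n + 2 * r)) * a \<in> S a b"
    by (intro closed generator_in_S)
  moreover obtain d where "s = n + 2 * r + d"
    using assms le_Suc_ex by blast
  ultimately show ?thesis by (simp add: algebra_simps)
qed

text \<open>The constant 6 is 3 times 2: \<open>r < n\<close> gives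
  \<open>n + 2 * r \<le> 3 * n\<close>, and \<open>n\<close> is at most twice the square root of
  \<open>t\<close>.\<close>

lemma in_S_of_sqrt_le:
  assumes "6 * sqrt (real t) \<le> real s" "t > 0"
  shows "a * s + b * t \<in> S a b"
proof -
  obtain n where n: "n \<ge> 1" "(n choose 2) \<le> t" "t < (Suc n choose 2)"
    using ex_choose_two_bracket by blast
  define r where "r = t - (n choose 2)"
  have t: "t = (n choose 2) + r" using n by (simp add: r_def)
  have "r < n" using n t by (simp add: Suc_choose_two)
  \<comment> \<open>For \<open>n \<ge> 2\<close>, \<open>n * n = 2 * (n choose 2) + n\<close> with
    \<open>n\<close> at most half of \<open>n * n\<close>; for \<open>n = 1\<close> positivity of
    \<open>t\<close> suffices.\<close>
  have "n * n \<le> 4 * t"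
  proof (cases "n = 1")
    case True
    then show ?thesis using assms by simp
  next
    case False
    then have "2 * n \<le> n * n" using n(1) by (intro mult_right_mono) auto
    then show ?thesis using n(2) two_times_choose_two[of n] by linarith
  qed
  then have "(real n)\<^sup>2 \<le> 4 * real t"
    by (metis of_nat_le_iff of_nat_mult of_nat_numeral power2_eq_square)
  then have "real n \<le> sqrt (4 * real t)"
    by (rule real_le_rsqrt)
  then have "3 * real n \<le> real s"
    using assms by (simp add: real_sqrt_mult)
  then have "n + 2 * r \<le> s" using \<open>r < n\<close> by linarith
  then show ?thesis unfolding t by (rule in_S_I)
qed

text \<open>The term \<open>a * b\<close> of the threshold pays for subtracting \<open>b * t\<close>
  with \<open>t \<le> a\<close>; the other term leaves a quotient \<open>s\<close> of at least
  \<open>6 * sqrt a\<close>.\<close>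

lemma in_S_of_large:
  assumes "a \<ge> 2" "coprime a b" "6 * (real a * sqrt (real a)) + real a * real b \<le> real z"
  shows "z \<in> S a b"
proof -
  obtain x where x: "[b * x = 1] (mod a)"
    using cong_solve_coprime_nat[of b a] assms(2) by (auto simp: coprime_commute)
  define t0 where "t0 = (x * z) mod a"
  \<comment> \<open>Residue 0 is represented by \<open>a\<close>, because
    \<open>in_S_of_sqrt_le\<close> asks for \<open>t > 0\<close>.\<close>
  define t where "t = (if t0 = 0 then a else t0)"
  have "t0 < a" using assms by (simp add: t0_def)
  then have t: "0 < t" "t \<le> a" using assms by (auto simp: t_def)
  have "[t = x * z] (mod a)"
    by (auto simp: t_def t0_def cong_def)
  then have "[b * t = b * (x * z)] (mod a)" by (rule cong_scalar_left)
  also have "b * (x * z) = b * x * z" by simp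
  also have "[b * x * z = 1 * z] (mod a)" using x by (rule cong_scalar_right)
  finally have cong: "[b * t = z] (mod a)" by simp
  have "real b * real t \<le> real a * real b"
    by (subst mult.commute) (use t in \<open>simp add: mult_right_mono\<close>)
  moreover have "0 \<le> real a * sqrt (real a)" by simp
  ultimately have "real (b * t) \<le> real z" using assms(3) unfolding of_nat_mult by linarith
  then have le: "b * t \<le> z" by linarith
  then have "a dvd z - b * t"
    using cong cong_altdef_nat[of "b * t" z a] cong_sym cong_altdef_nat by blast
  then obtain s where "z - b * t = a * s" by blast
  then have z: "z = a * s + b * t" using le by simp
  have "6 * (real a * sqrt (real a)) \<le> real a * real s"
    using assms(3) \<open>real b * real t \<le> real a * real b\<close> unfolding z by simp
  then have "real a * (6 * sqrt (real a)) \<le> real a * real s" by (simp add: mult.left_commute)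
  then have "6 * sqrt (real a) \<le> real s" using assms(1) by simp
  moreover have "sqrt (real t) \<le> sqrt (real a)" using t by simp
  ultimately have "6 * sqrt (real t) \<le> real s" by linarith
  then show ?thesis unfolding z using t by (intro in_S_of_sqrt_le) auto
qed

text \<open>In any representation \<open>a * s' + b * t'\<close>, coprimality forces
  \<open>t'\<close> to be -1 modulo \<open>a\<close>, so \<open>t' \<ge> a - 1\<close> and hence
  \<open>s' \<le> s\<close>; then \<open>s' choose 2\<close> is too small for
  \<open>t'\<close>.\<close>

lemma notin_S:
  assumes "a \<ge> 1" "coprime a b" "(s choose 2) < a - 1"
  shows "a * s + b * (a - 1) \<notin> S a b"
proof
  assume "a * s + b * (a - 1) \<in> S a b"
  then obtain s' t' where eq: "a * s + b * (a - 1) = a * s' + b * t'" and t': "t' \<le> (s' choose 2)"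
    by (rule in_S_E)
  \<comment> \<open>Adding \<open>b\<close> to both sides turns \<open>b * (a - 1)\<close> into a
    multiple of \<open>a\<close>.\<close>
  have "a * s + a * b = a * s + b * (a - 1) + b"
    using assms(1) by (cases a) auto
  also have "\<dots> = a * s' + b * (t' + 1)" using eq by (simp add: algebra_simps)
  finally have "a * s' + b * (t' + 1) = a * (s + b)" by (simp add: algebra_simps)
  then have "a dvd b * (t' + 1)"
    by (metis dvd_add_right_iff dvd_triv_left)
  then have "a dvd t' + 1" using assms(2) coprime_dvd_mult_right_iff by blast
  then have "a \<le> t' + 1" by (rule dvd_imp_le) simp
  then have t'_ge: "a - 1 \<le> t'" by simp
  then have "b * (a - 1) \<le> b * t'" by simp
  then have "a * s' \<le> a * s" using eq by linarith
  then have "s' \<le> s" using assms(1) by simp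
  then have "(s' choose 2) \<le> (s choose 2)"
    by (metis choose_two_add le_add_diff_inverse le_add1 add.assoc)
  then show False using t' t'_ge assms(3) by linarith
qed

text \<open>The witness \<open>l\<close> and the bound \<open>u\<close> confine the search to a
  finite nonempty set, so the maximum behind \<open>GREATEST\<close> exists.\<close>

lemma Frobenius_bounds:
  fixes l u :: int
  assumes "l \<notin> int ` M" "\<And>z. z \<notin> int ` M \<Longrightarrow> z \<le> u"
  shows "l \<le> Frobenius M" "Frobenius M \<le> u"
proof -
  let ?A = "{z. l \<le> z \<and> z \<notin> int ` M}"
  have "?A \<subseteq> {l..u}" using assms(2) by auto
  then have fin: "finite ?A" by (rule finite_subset) simp
  have ne: "?A \<noteq> {}" using assms(1) by auto
  have "Frobenius M = Max ?A"
    unfolding Frobenius_def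
  proof (rule Greatest_equality)
    show "Max ?A \<notin> int ` M" using Max_in[OF fin ne] by simp
    fix z assume z: "z \<notin> int ` M"
    show "z \<le> Max ?A"
    proof (cases "l \<le> z")
      case True
      then show ?thesis using z fin by (intro Max_ge) auto
    next
      case False
      then show ?thesis using Max_in[OF fin ne] by simp
    qed
  qed
  then show "l \<le> Frobenius M" "Frobenius M \<le> u"
    using Max_in[OF fin ne] assms(2) by auto
qed

theorem corollary8p3:
  shows "\<exists>c1 c2 :: real. c1 > 0 \<and> c2 > 0 \<and>
    (\<forall>a b :: nat. a \<ge> 2 \<longrightarrow> b \<ge> 1 \<longrightarrow> gcd a b = 1 \<longrightarrow>
      c1 * (real a powr (3/2) + real a * real b) \<le> real_of_int (Frobenius (S a b)) \<and>
      real_of_int (Frobenius (S a b)) \<le> c2 * (real a powr (3/2) + real a * real b))"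
proof -
  have "1 / 2 * (real a powr (3/2) + real a * real b) \<le> real_of_int (Frobenius (S a b)) \<and>
      real_of_int (Frobenius (S a b)) \<le> 6 * (real a powr (3/2) + real a * real b)"
    if a: "a \<ge> 2" and "gcd a b = 1" for a b :: nat
  proof -
    have cop: "coprime a b" using that by (simp add: coprime_iff_gcd_eq_1)
    have "real a powr (3/2) = real a powr (1 + 1/2)" by simp
    also have "\<dots> = real a * sqrt (real a)"
      using a by (subst powr_add) (simp add: powr_half_sqrt)
    finally have powr: "real a powr (3/2) = real a * sqrt (real a)" .
    define U where "U = 6 * (real a * sqrt (real a)) + real a * real b"
    have U0: "U \<ge> 0" by (simp add: U_def)
    \<comment> \<open>This is the largest \<open>s\<close> that \<open>notin_S\<close> admits, so it
      has the order of \<open>sqrt a\<close>.\<close>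
    obtain s where s: "s \<ge> 1" "(s choose 2) \<le> a - 2" "a - 2 < (Suc s choose 2)"
      using ex_choose_two_bracket by blast
    have lower: "int (a * s + b * (a - 1)) \<notin> int ` S a b"
      using notin_S[of a b s] a cop s(2) by (simp add: inj_image_mem_iff del: of_nat_add of_nat_mult)
    have upper: "z \<le> \<lfloor>U\<rfloor>" if "z \<notin> int ` S a b" for z
    proof (rule ccontr)
      assume "\<not> z \<le> \<lfloor>U\<rfloor>"
      then have z: "U \<le> real_of_int z" by linarith
      then have "z \<ge> 0" using U0 by linarith
      then have "nat z \<in> S a b" using z a cop
        by (intro in_S_of_large) (auto simp: U_def)
      with \<open>z \<ge> 0\<close> have "z \<in> int ` S a b" by (metis image_eqI nat_0_le)
      with that show False by blast
    qed
    note F = Frobenius_bounds[OF lower upper]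
    \<comment> \<open>Doubling the upper bracket gives \<open>2 * a - 2 \<le> Suc s * s\<close>, and
      \<open>a \<le> 2 * a - 2\<close> because \<open>a \<ge> 2\<close>.\<close>
    have "a \<le> Suc s * s"
      using s(3) a two_times_choose_two[of "Suc s"] by (simp add: algebra_simps)
    also have "\<dots> \<le> (2 * s) * (2 * s)" using s(1) by (intro mult_mono) auto
    finally have "real a \<le> (2 * real s)\<^sup>2"
      by (metis of_nat_le_iff of_nat_mult of_nat_numeral power2_eq_square)
    then have "sqrt (real a) \<le> 2 * real s" by (intro real_le_lsqrt) auto
    then have "real a * sqrt (real a) \<le> real a * (2 * real s)" by (intro mult_left_mono) auto
    moreover have "real a * real b \<le> 2 * real (b * (a - 1))"
    proof -
      have "a * b \<le> 2 * (a - 1) * b" using a by (intro mult_right_mono) auto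
      also have "\<dots> = 2 * (b * (a - 1))" by simp
      finally show ?thesis by (metis of_nat_le_iff of_nat_mult of_nat_numeral)
    qed
    \<comment> \<open>The factor 1/2 serves both terms: \<open>s\<close> is at least half of
      \<open>sqrt a\<close>, and \<open>a - 1\<close> at least half of \<open>a\<close>.\<close>
    ultimately have "1 / 2 * (real a * sqrt (real a) + real a * real b)
        \<le> real (a * s + b * (a - 1))"
      unfolding of_nat_add of_nat_mult by (simp add: algebra_simps)
    also have "\<dots> \<le> real_of_int (Frobenius (S a b))" using F(1) by linarith
    finally have 1: "1 / 2 * (real a * sqrt (real a) + real a * real b)
        \<le> real_of_int (Frobenius (S a b))" .
    have "real_of_int (Frobenius (S a b)) \<le> U" using F(2) by linarith
    also have "\<dots> \<le> 6 * (real a * sqrt (real a) + real a * real b)" by (simp add: U_def)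
    finally show ?thesis using 1 unfolding powr by blast
  qed
  then show ?thesis by (intro exI[of _ "1 / 2"] exI[of _ 6]) auto
qed

end
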